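(* Let $X$ be a uniformly joinable uniform space with a countable base of entourages. If $f\colon X\to Y$ is a generalized uniform covering map, then every fiber $f^{-1}(y)$, $y\in Y$, is complete.
   Context: $f(E)=\{(f(x),f(y)):(x,y)\in E\}$; a surjection generates the uniform structure of its range if the sets $f(E)$ form a base of it. $R(X,E)$ is the Rips complex (vertex set $X$, simplices finite $F$ with $F\times F\subset E$); $e(x,y)$ the edge-path; $E$-chains are sequences with consecutive pairs in $E$, viewed as edge-paths. Paths $c,d$ in $R(X,E)$ with end-points in $X$ are $E$-homotopic if their initial points $x_c,x_d$ and terminal points $y_c,y_d$ satisfy $(x_c,x_d),(y_c,y_d)\in E$ and $c\simeq e(x_c,x_d)\ast d\ast e(y_d,y_c)$ rel. end-points in $R(X,E)$. A generalized path from $x$ to $y$ is a family $\{[c_E]\}_E$ of homotopy classes rel. end-points of paths from $x$ to $y$ in $R(X,E)$ with $c_F\simeq c_E$ in $R(X,E)$ for $F\subset E$; it is $F$-short if $(x,y)\in F$ and $c_F\simeq e(x,y)$ in $R(X,F)$; $c,d$ are $F$-homotopic if $c_F$ is $F$-homotopic to $d_F$. $\widetilde f(c)_F=[f_E(c_E)]$, $E=f^{-1}(F)$. Uniformly joinable: for each $E$ there is $F$ with every $(x,y)\in F$ joined by an $E$-short generalized path. A generalized uniform covering map is an $f\colon X\to Y$ generating the uniform structure of $Y$ with: GP1 (every generalized path in $Y$ from $f(x_0)$ is $\widetilde f(d)$ for some generalized path $d$ from $x_0$); GP2 (for each $E$ there is $F$ such that generalized paths with common origin are $E$-homotopic if their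 images under $\widetilde f$ are $f(F)$-homotopic); C1 (for each $E$ there is $F$ such that every $f(F)$-chain from $f(x_0)$ lifts to an $E$-chain from $x_0$); C2 (for each $E$ there is $F$ such that $F$-chains with common origin are $E$-homotopic if their images are $f(F)$-homotopic). *)

theory Defs
  imports "HOL-Analysis.Analysis"
begin

definition entourages :: "('a::uniform_space \<times> 'a) set set" where
  "entourages = {E. eventually (\<lambda>p. p \<in> E) uniformity}"

definition countable_uniform_base :: "'a::uniform_space itself \<Rightarrow> bool" where
  "countable_uniform_base _ \<longleftrightarrow>
     (\<exists>B. countable B \<and> B \<subseteq> (entourages :: ('a \<times> 'a) set set) \<and>
          (\<forall>E\<in>entourages. \<exists>B'\<in>B. B' \<subseteq> E))"

definition rel_image :: "('a \<Rightarrow> 'b) \<Rightarrow> ('a \<times> 'a) set \<Rightarrow> ('b \<times> 'b) set" where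
  "rel_image f E = map_prod f f ` E"

definition generates_uniformity :: "('a::uniform_space \<Rightarrow> 'b::uniform_space) \<Rightarrow> bool" where
  "generates_uniformity f \<longleftrightarrow> surj f \<and>
     (\<forall>E\<in>entourages. rel_image f E \<in> entourages) \<and>
     (\<forall>F\<in>entourages. \<exists>E\<in>entourages. rel_image f E \<subseteq> F)"

definition complete_subset :: "'a::uniform_space set \<Rightarrow> bool" where
  "complete_subset A \<longleftrightarrow>
     (\<forall>F. F \<noteq> bot \<and> F \<le> principal A \<and> cauchy_filter F \<longrightarrow> (\<exists>x\<in>A. F \<le> nhds x))"

definition supp :: "('a \<Rightarrow> real) \<Rightarrow> 'a set" where
  "supp u = {x. u x \<noteq> 0}"

text \<open>Points of the realization of R(X,E): finitely supported nonnegative weights summing to 1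
  whose support F is a simplex, i.e. F \<times> F \<subseteq> E.\<close>
definition rips :: "('a \<times> 'a) set \<Rightarrow> ('a \<Rightarrow> real) set" where
  "rips E = {u. finite (supp u) \<and> (\<forall>x. 0 \<le> u x) \<and> sum u (supp u) = 1 \<and> supp u \<times> supp u \<subseteq> E}"

definition l1dist :: "('a \<Rightarrow> real) \<Rightarrow> ('a \<Rightarrow> real) \<Rightarrow> real" where
  "l1dist u v = (\<Sum>x\<in>supp u \<union> supp v. \<bar>u x - v x\<bar>)"

definition rips_top :: "('a \<times> 'a) set \<Rightarrow> ('a \<Rightarrow> real) topology" where
  "rips_top E = Metric_space.mtopology (rips E) l1dist"

definition vert :: "'a \<Rightarrow> 'a \<Rightarrow> real" where
  "vert x = (\<lambda>z. if z = x then 1 else 0)"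

definition edge :: "'a \<Rightarrow> 'a \<Rightarrow> real \<Rightarrow> 'a \<Rightarrow> real" where
  "edge x y = (\<lambda>t. (\<lambda>z. (1 - t) * vert x z + t * vert y z))"

definition rpath :: "('a \<times> 'a) set \<Rightarrow> 'a \<Rightarrow> 'a \<Rightarrow> (real \<Rightarrow> 'a \<Rightarrow> real) \<Rightarrow> bool" where
  "rpath E x y c \<longleftrightarrow> continuous_map (top_of_set {0..1}) (rips_top E) c \<and>
                      c 0 = vert x \<and> c 1 = vert y"

definition rhom :: "('a \<times> 'a) set \<Rightarrow> (real \<Rightarrow> 'a \<Rightarrow> real) \<Rightarrow> (real \<Rightarrow> 'a \<Rightarrow> real) \<Rightarrow> bool" where
  "rhom E c d \<longleftrightarrow> homotopic_with (\<lambda>h. h 0 = c 0 \<and> h 1 = c 1) (top_of_set {0..1}) (rips_top E) c d"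

definition ehom :: "('a \<times> 'a) set \<Rightarrow> 'a \<Rightarrow> 'a \<Rightarrow> (real \<Rightarrow> 'a \<Rightarrow> real)
                     \<Rightarrow> 'a \<Rightarrow> 'a \<Rightarrow> (real \<Rightarrow> 'a \<Rightarrow> real) \<Rightarrow> bool" where
  "ehom E xc yc c xd yd d \<longleftrightarrow> (xc, xd) \<in> E \<and> (yc, yd) \<in> E \<and>
      rhom E c (edge xc xd +++ d +++ edge yd yc)"

text \<open>Simplicial map R(X,E) -> R(Y,F) induced by f, on barycentric coordinates.\<close>
definition smap :: "('a \<Rightarrow> 'b) \<Rightarrow> ('a \<Rightarrow> real) \<Rightarrow> 'b \<Rightarrow> real" where
  "smap f u = (\<lambda>y. sum u {x \<in> supp u. f x = y})"

text \<open>A generalized path from x to y, represented by a choice of representatives c E of the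
  homotopy classes [c_E], one for each entourage E.\<close>
definition gpath :: "'a::uniform_space \<Rightarrow> 'a \<Rightarrow> (('a \<times> 'a) set \<Rightarrow> real \<Rightarrow> 'a \<Rightarrow> real) \<Rightarrow> bool" where
  "gpath x y c \<longleftrightarrow> (\<forall>E\<in>entourages. rpath E x y (c E)) \<and>
     (\<forall>E\<in>entourages. \<forall>F\<in>entourages. F \<subseteq> E \<longrightarrow> rhom E (c F) (c E))"

definition gshort :: "('a \<times> 'a) set \<Rightarrow> 'a \<Rightarrow> 'a \<Rightarrow> (('a \<times> 'a) set \<Rightarrow> real \<Rightarrow> 'a \<Rightarrow> real) \<Rightarrow> bool" where
  "gshort F x y c \<longleftrightarrow> (x, y) \<in> F \<and> rhom F (c F) (edge x y)"

definition ghom :: "('a \<times> 'a) set \<Rightarrow> 'a \<Rightarrow> 'a \<Rightarrow> (('a \<times> 'a) set \<Rightarrow> real \<Rightarrow> 'a \<Rightarrow> real)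
                     \<Rightarrow> 'a \<Rightarrow> 'a \<Rightarrow> (('a \<times> 'a) set \<Rightarrow> real \<Rightarrow> 'a \<Rightarrow> real) \<Rightarrow> bool" where
  "ghom F x y c x' y' d \<longleftrightarrow> ehom F x y (c F) x' y' (d F)"

definition gmap :: "('a \<Rightarrow> 'b) \<Rightarrow> (('a \<times> 'a) set \<Rightarrow> real \<Rightarrow> 'a \<Rightarrow> real)
                     \<Rightarrow> ('b \<times> 'b) set \<Rightarrow> real \<Rightarrow> 'b \<Rightarrow> real" where
  "gmap f c F = (\<lambda>t. smap f (c {(x, y). (f x, f y) \<in> F} t))"

definition uniformly_joinable :: "'a::uniform_space itself \<Rightarrow> bool" where
  "uniformly_joinable _ \<longleftrightarrow>
     (\<forall>E\<in>(entourages :: ('a \<times> 'a) set set). \<exists>F\<in>entourages. \<forall>(x, y)\<in>F.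
        \<exists>c. gpath x y c \<and> gshort E x y c)"

definition is_chain :: "('a \<times> 'a) set \<Rightarrow> 'a list \<Rightarrow> bool" where
  "is_chain E xs \<longleftrightarrow> xs \<noteq> [] \<and> (\<forall>i. Suc i < length xs \<longrightarrow> (xs ! i, xs ! Suc i) \<in> E)"

fun chain_path :: "'a list \<Rightarrow> real \<Rightarrow> 'a \<Rightarrow> real" where
  "chain_path [] = (\<lambda>t. (\<lambda>z. 0))"
| "chain_path [x] = (\<lambda>t. vert x)"
| "chain_path (x # y # zs) = edge x y +++ chain_path (y # zs)"

definition chain_hom :: "('a \<times> 'a) set \<Rightarrow> 'a list \<Rightarrow> 'a list \<Rightarrow> bool" where
  "chain_hom E xs ys \<longleftrightarrow>
     ehom E (hd xs) (last xs) (chain_path xs) (hd ys) (last ys) (chain_path ys)"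

definition gen_uniform_covering :: "('a::uniform_space \<Rightarrow> 'b::uniform_space) \<Rightarrow> bool" where
  "gen_uniform_covering f \<longleftrightarrow> generates_uniformity f \<and>
    \<comment> \<open>GP1\<close>
    (\<forall>x0 y c. gpath (f x0) y c \<longrightarrow>
        (\<exists>x d. gpath x0 x d \<and> f x = y \<and>
               (\<forall>F\<in>entourages. rhom F (gmap f d F) (c F)))) \<and>
    \<comment> \<open>GP2\<close>
    (\<forall>E\<in>entourages. \<exists>F\<in>entourages. \<forall>x0 y c y' d.
        gpath x0 y c \<and> gpath x0 y' d \<and>
        ghom (rel_image f F) (f x0) (f y) (gmap f c) (f x0) (f y') (gmap f d)
        \<longrightarrow> ghom E x0 y c x0 y' d) \<and>
    \<comment> \<open>C1\<close>
    (\<forall>E\<in>entourages. \<exists>F\<in>entourages. \<forall>x0 ys.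
        is_chain (rel_image f F) ys \<and> hd ys = f x0 \<longrightarrow>
        (\<exists>xs. is_chain E xs \<and> hd xs = x0 \<and> map f xs = ys)) \<and>
    \<comment> \<open>C2\<close>
    (\<forall>E\<in>entourages. \<exists>F\<in>entourages. \<forall>xs xs'.
        is_chain F xs \<and> is_chain F xs' \<and> hd xs = hd xs' \<and>
        chain_hom (rel_image f F) (map f xs) (map f xs')
        \<longrightarrow> chain_hom E xs xs')"

end

theory Submission
  imports Defs
begin

text \<open>A Cauchy filter on a fibre over \<open>y\<close> yields points \<open>x n\<close> of the fibre and \<open>E n\<close>-short
  generalized paths \<open>c n\<close> from \<open>x n\<close> to \<open>x (n + 1)\<close>, where the \<open>E n\<close> form a decreasing base.
  The image of \<open>c n\<close> is a loop at \<open>y\<close> that is null-homotopic at any given scale for large \<open>n\<close>, so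
  the images of the finite concatenations of the \<open>c n\<close> stabilize up to homotopy at every scale
  and define a generalized loop at \<open>y\<close>. By GP1 it lifts to a generalized path from \<open>x 0\<close> to some
  point \<open>x'\<close> of the fibre, and GP2 compares the lift with the finite concatenations: their
  end-points \<open>x n\<close> converge to \<open>x'\<close>.\<close>

section \<open>The l1 metric on Rips complexes\<close>

lemma l1dist_superset:
  assumes "finite S" "supp u \<union> supp v \<subseteq> S"
  shows "l1dist u v = (\<Sum>x\<in>S. \<bar>u x - v x\<bar>)"
  unfolding l1dist_def
  by (rule sum.mono_neutral_left) (use assms in \<open>auto simp: supp_def\<close>)

lemma Metric_space_rips: "Metric_space (rips E) l1dist"
proof
  show "0 \<le> l1dist u v" for u v :: "'a \<Rightarrow> real"
    by (simp add: l1dist_def sum_nonneg)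
  show "l1dist u v = l1dist v u" for u v :: "'a \<Rightarrow> real"
    by (simp add: l1dist_def Un_commute abs_minus_commute)
  show "l1dist u v = 0 \<longleftrightarrow> u = v" if "u \<in> rips E" "v \<in> rips E" for u v
  proof
    assume "l1dist u v = 0"
    then have "\<forall>x\<in>supp u \<union> supp v. \<bar>u x - v x\<bar> = 0"
      unfolding l1dist_def
      by (subst (asm) sum_nonneg_eq_0_iff) (use that in \<open>auto simp: rips_def\<close>)
    then have "\<bar>u x - v x\<bar> = 0" if "x \<in> supp u \<union> supp v" for x
      using that by (rule bspec)
    moreover have "\<bar>u x - v x\<bar> = 0" if "x \<notin> supp u \<union> supp v" for x
      using that by (simp add: supp_def)
    ultimately have "\<bar>u x - v x\<bar> = 0" for x
      by metis
    then show "u = v" by auto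
  qed (simp add: l1dist_def)
  show "l1dist u w \<le> l1dist u v + l1dist v w"
    if "u \<in> rips E" "v \<in> rips E" "w \<in> rips E" for u v w
  proof -
    \<comment> \<open>The three distances are summed over different supports; over one common finite
      set they can be compared term by term.\<close>
    let ?S = "supp u \<union> supp v \<union> supp w"
    have fin: "finite ?S"
      using that by (auto simp: rips_def)
    have "l1dist u w = (\<Sum>x\<in>?S. \<bar>u x - w x\<bar>)"
      using fin by (intro l1dist_superset) auto
    also have "\<dots> \<le> (\<Sum>x\<in>?S. \<bar>u x - v x\<bar> + \<bar>v x - w x\<bar>)"
      by (intro sum_mono) auto
    also have "\<dots> = l1dist u v + l1dist v w"
      unfolding sum.distrib
      by (intro arg_cong2[where f = "(+)"] l1dist_superset[symmetric] fin) auto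
    finally show ?thesis .
  qed
qed

text \<open>In the metric topology \<delta> = \<epsilon> works. Inclusions between Rips complexes
  and simplicial maps both get their continuity from this criterion.\<close>

lemma continuous_map_rips_nonexpansive:
  assumes "\<And>u. u \<in> rips E \<Longrightarrow> g u \<in> rips F"
    and "\<And>u v. u \<in> rips E \<Longrightarrow> v \<in> rips E \<Longrightarrow> l1dist (g u) (g v) \<le> l1dist u v"
  shows "continuous_map (rips_top E) (rips_top F) g"
  unfolding rips_top_def Metric_space.metric_continuous_map[OF Metric_space_rips Metric_space_rips]
proof (intro conjI ballI allI impI)
  show "g ` rips E \<subseteq> rips F"
    using assms(1) by blast
  show "\<exists>\<delta>>0. \<forall>v. v \<in> rips E \<and> l1dist u v < \<delta> \<longrightarrow> l1dist (g u) (g v) < \<epsilon>"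
    if "u \<in> rips E" "0 < \<epsilon>" for u \<epsilon>
    using assms(2)[OF that(1)] that(2) by (intro exI[of _ \<epsilon>]) (fastforce intro: le_less_trans)
qed

lemma continuous_map_rips_mono:
  assumes "E \<subseteq> F"
  shows "continuous_map (rips_top E) (rips_top F) id"
  by (rule continuous_map_rips_nonexpansive) (use assms in \<open>auto simp: rips_def\<close>)

section \<open>Simplicial maps\<close>

lemma smap_superset:
  assumes "finite S" "supp u \<subseteq> S"
  shows "smap f u y = sum u {x \<in> S. f x = y}"
  unfolding smap_def
  by (rule sum.mono_neutral_left) (use assms in \<open>auto simp: supp_def\<close>)

lemma supp_smap: "supp (smap f u) \<subseteq> f ` supp u"
proof
  fix y assume y: "y \<in> supp (smap f u)"
  have "{x \<in> supp u. f x = y} = {}" if "y \<notin> f ` supp u"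
    using that by blast
  then have "smap f u y = 0" if "y \<notin> f ` supp u"
    using that unfolding smap_def by (metis sum.empty)
  then show "y \<in> f ` supp u"
    using y unfolding supp_def by blast
qed

lemma smap_in_rips:
  assumes u: "u \<in> rips E" and EF: "\<And>x y. (x, y) \<in> E \<Longrightarrow> (f x, f y) \<in> F"
  shows "smap f u \<in> rips F"
proof -
  have fin: "finite (supp u)" and nonneg: "\<And>x. 0 \<le> u x" and one: "sum u (supp u) = 1"
    and simplex: "supp u \<times> supp u \<subseteq> E"
    using u unfolding rips_def by blast+
  \<comment> \<open>Extending the sum by zero terms to the image of the support makes the index set
    fit the partition of \<open>supp u\<close> into fibers of \<open>f\<close>, so the total weight
    is preserved.\<close>
  have "sum (smap f u) (supp (smap f u)) = sum (smap f u) (f ` supp u)"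
  proof (rule sum.mono_neutral_left)
    show "finite (f ` supp u)" using fin by simp
    show "\<forall>y\<in>f ` supp u - supp (smap f u). smap f u y = 0"
      unfolding supp_def[of "smap f u"] by blast
  qed (rule supp_smap)
  also have "\<dots> = sum u (supp u)"
    unfolding smap_def using sum.image_gen[OF fin, of u f] by simp
  finally have "sum (smap f u) (supp (smap f u)) = 1"
    using one by simp
  moreover have "finite (supp (smap f u))"
    using finite_subset[OF supp_smap finite_imageI[OF fin]] .
  moreover have "0 \<le> smap f u y" for y
    by (simp add: smap_def sum_nonneg nonneg)
  moreover have "supp (smap f u) \<times> supp (smap f u) \<subseteq> F"
  proof (intro subrelI, elim SigmaE2)
    fix a b assume "a \<in> supp (smap f u)" "b \<in> supp (smap f u)"
    then obtain x y where "a = f x" "b = f y" "x \<in> supp u" "y \<in> supp u"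
      using supp_smap[of f u] by blast
    then show "(a, b) \<in> F"
      using EF[of x y] simplex by blast
  qed
  ultimately show ?thesis
    by (simp add: rips_def)
qed

text \<open>Adding up weights within a fiber of \<open>f\<close> can only cancel differences: this
  is the triangle inequality fiber by fiber, summed over the image of both supports.\<close>

lemma smap_nonexpansive:
  assumes "finite (supp u)" "finite (supp v)"
  shows "l1dist (smap f u) (smap f v) \<le> l1dist u v"
proof -
  let ?S = "supp u \<union> supp v"
  have fin: "finite ?S" using assms by simp
  have "l1dist (smap f u) (smap f v) = (\<Sum>y\<in>f ` ?S. \<bar>smap f u y - smap f v y\<bar>)"
    by (rule l1dist_superset) (use fin supp_smap[of f u] supp_smap[of f v] in auto)
  also have "\<dots> = (\<Sum>y\<in>f ` ?S. \<bar>\<Sum>x | x \<in> ?S \<and> f x = y. u x - v x\<bar>)"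
    using smap_superset[OF fin, of u f] smap_superset[OF fin, of v f] by (simp add: sum_subtractf)
  also have "\<dots> \<le> (\<Sum>y\<in>f ` ?S. \<Sum>x | x \<in> ?S \<and> f x = y. \<bar>u x - v x\<bar>)"
    by (intro sum_mono sum_abs)
  also have "\<dots> = l1dist u v"
    unfolding l1dist_def using sum.image_gen[OF fin, of "\<lambda>x. \<bar>u x - v x\<bar>" f] by simp
  finally show ?thesis .
qed

lemma continuous_map_smap:
  assumes "\<And>x y. (x, y) \<in> E \<Longrightarrow> (f x, f y) \<in> F"
  shows "continuous_map (rips_top E) (rips_top F) (smap f)"
proof (rule continuous_map_rips_nonexpansive)
  show "smap f u \<in> rips F" if "u \<in> rips E" for u
    using that assms by (rule smap_in_rips)
  show "l1dist (smap f u) (smap f v) \<le> l1dist u v" if "u \<in> rips E" "v \<in> rips E" for u v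
    using that by (intro smap_nonexpansive) (simp_all add: rips_def)
qed

lemma smap_vert [simp]: "smap f (vert x) = vert (f x)"
proof
  fix y
  have "supp (vert x) = {x}" by (auto simp: supp_def vert_def)
  then have "smap f (vert x) y = sum (vert x) {z \<in> {x}. f z = y}"
    by (simp add: smap_def)
  also have "{z \<in> {x}. f z = y} = (if f x = y then {x} else {})"
    by auto
  also have "sum (vert x) \<dots> = vert (f x) y"
    by (simp add: vert_def)
  finally show "smap f (vert x) y = vert (f x) y" .
qed

lemma edge_self [simp]: "edge x x t = vert x"
  by (auto simp: edge_def algebra_simps)

lemma smap_edge: "smap f (edge x y t) = edge (f x) (f y) t"
proof
  fix z
  have "smap f (edge x y t) z = sum (edge x y t) {w \<in> {x, y}. f w = z}"
    by (rule smap_superset) (auto simp: supp_def edge_def vert_def)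
  also have "\<dots> = (1 - t) * sum (vert x) {w \<in> {x, y}. f w = z} + t * sum (vert y) {w \<in> {x, y}. f w = z}"
    by (simp add: edge_def sum.distrib sum_distrib_left)
  also have "sum (vert x) {w \<in> {x, y}. f w = z} = smap f (vert x) z"
    by (rule smap_superset[symmetric]) (auto simp: supp_def vert_def)
  also have "sum (vert y) {w \<in> {x, y}. f w = z} = smap f (vert y) z"
    by (rule smap_superset[symmetric]) (auto simp: supp_def vert_def)
  finally show "smap f (edge x y t) z = edge (f x) (f y) t z"
    by (simp add: edge_def)
qed

lemma smap_joinpaths: "smap f ((p +++ q) t) = ((\<lambda>t. smap f (p t)) +++ (\<lambda>t. smap f (q t))) t"
  by (simp add: joinpaths_def)

section \<open>Homotopy of paths rel. end-points\<close>

lemma rhom_endpoints: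
  assumes "rhom E c d"
  shows "d 0 = c 0" "d 1 = c 1"
  using homotopic_with_imp_property[OF assms[unfolded rhom_def]] by auto

lemma rhom_continuous:
  assumes "rhom E c d"
  shows "continuous_map (top_of_set {0..1}) (rips_top E) c"
    "continuous_map (top_of_set {0..1}) (rips_top E) d"
  using homotopic_with_imp_continuous_maps[OF assms[unfolded rhom_def]] by auto

lemma rhom_refl: "rhom E c c \<longleftrightarrow> continuous_map (top_of_set {0..1}) (rips_top E) c"
  by (simp add: rhom_def)

lemma rhom_sym:
  assumes "rhom E c d"
  shows "rhom E d c"
  using homotopic_with_symD[OF assms[unfolded rhom_def]] rhom_endpoints[OF assms]
  by (simp add: rhom_def)

lemma rhom_trans [trans]:
  assumes "rhom E c d" "rhom E d e"
  shows "rhom E c e"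
  using homotopic_with_trans[OF assms(1)[unfolded rhom_def]] assms(2) rhom_endpoints[OF assms(1)]
  by (simp add: rhom_def)

lemma rhom_compose:
  assumes "rhom E c d" "continuous_map (rips_top E) (rips_top F) g"
  shows "rhom F (\<lambda>t. g (c t)) (\<lambda>t. g (d t))"
  using homotopic_with_compose_continuous_map_left[OF assms(1)[unfolded rhom_def] assms(2),
      of "\<lambda>h. h 0 = g (c 0) \<and> h 1 = g (c 1)"]
  by (simp add: rhom_def o_def)

lemma rhom_mono:
  assumes "rhom E c d" "E \<subseteq> F"
  shows "rhom F c d"
  using rhom_compose[OF assms(1) continuous_map_rips_mono[OF assms(2)]] by simp

lemma rhom_smap:
  assumes "rhom E c d" "\<And>x y. (x, y) \<in> E \<Longrightarrow> (f x, f y) \<in> F"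
  shows "rhom F (\<lambda>t. smap f (c t)) (\<lambda>t. smap f (d t))"
  using rhom_compose[OF assms(1) continuous_map_smap[OF assms(2)]] by simp

text \<open>The first coordinate is the homotopy parameter, the second the path parameter. The two
  maps are pasted along the closed halves of the square, and \<open>hk\<close> makes them agree on
  the common line.\<close>

lemma continuous_map_joinpaths_family:
  fixes h k :: "real \<times> real \<Rightarrow> 'a::topological_space"
  assumes h: "continuous_map (top_of_set ({0..1} \<times> {0..1})) T h"
    and k: "continuous_map (top_of_set ({0..1} \<times> {0..1})) T k"
    and hk: "\<And>s. s \<in> {0..1} \<Longrightarrow> h (s, 1) = k (s, 0)"
  shows "continuous_map (top_of_set ({0..1} \<times> {0..1})) T
           (\<lambda>p. ((\<lambda>t. h (fst p, t)) +++ (\<lambda>t. k (fst p, t))) (snd p))"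
proof -
  let ?I = "top_of_set ({0..1::real} \<times> {0..1::real})"
  have "continuous_map ?I T (\<lambda>p. if snd p \<le> 1/2 then (h \<circ> (\<lambda>p. (fst p, 2 * snd p))) p
          else (k \<circ> (\<lambda>p. (fst p, 2 * snd p - 1))) p)"
  proof (rule continuous_map_cases_le)
    show "continuous_map (subtopology ?I {x \<in> topspace ?I. snd x \<le> 1/2}) T (h \<circ> (\<lambda>p. (fst p, 2 * snd p)))"
      by (rule continuous_map_compose[OF _ h])
        (auto simp: subtopology_subtopology intro!: continuous_intros)
    show "continuous_map (subtopology ?I {x \<in> topspace ?I. 1/2 \<le> snd x}) T (k \<circ> (\<lambda>p. (fst p, 2 * snd p - 1)))"
      by (rule continuous_map_compose[OF _ k])
        (auto simp: subtopology_subtopology intro!: continuous_intros)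
    show "(h \<circ> (\<lambda>p. (fst p, 2 * snd p))) p = (k \<circ> (\<lambda>p. (fst p, 2 * snd p - 1))) p"
      if "p \<in> topspace ?I" "snd p = 1/2" for p
      using hk[of "fst p"] that by (auto simp del: divide_eq_eq_numeral1 eq_divide_eq_numeral1)
  qed (auto intro!: continuous_intros)
  then show ?thesis
    by (simp add: joinpaths_def o_def cong: if_cong)
qed

text \<open>The end-point condition sees only the arguments 0 and 1, which lie in the interval;
  hence an explicit homotopy on the square has to match \<open>c\<close> and \<open>d\<close> only
  on \<open>{0..1}\<close>.\<close>

lemma rhom_iff:
  "rhom E c d \<longleftrightarrow> (\<exists>h :: real \<times> real \<Rightarrow> 'a \<Rightarrow> real. continuous_map (top_of_set ({0..1} \<times> {0..1})) (rips_top E) h \<and>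
      (\<forall>t\<in>{0..1}. h (0, t) = c t) \<and> (\<forall>t\<in>{0..1}. h (1, t) = d t) \<and>
      (\<forall>s\<in>{0..1}. h (s, 0) = c 0 \<and> h (s, 1) = c 1))"
  unfolding rhom_def by (subst homotopic_with) auto

lemma rhom_join:
  assumes c: "rhom E c c'" and d: "rhom E d d'" and cd: "c 1 = d 0"
  shows "rhom E (c +++ d) (c' +++ d')"
proof -
  obtain h :: "real \<times> real \<Rightarrow> _" where h: "continuous_map (top_of_set ({0..1} \<times> {0..1})) (rips_top E) h"
    "\<forall>t\<in>{0..1}. h (0, t) = c t" "\<forall>t\<in>{0..1}. h (1, t) = c' t"
    "\<forall>s\<in>{0..1}. h (s, 0) = c 0 \<and> h (s, 1) = c 1"
    using c unfolding rhom_iff by blast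
  obtain k :: "real \<times> real \<Rightarrow> _" where k: "continuous_map (top_of_set ({0..1} \<times> {0..1})) (rips_top E) k"
    "\<forall>t\<in>{0..1}. k (0, t) = d t" "\<forall>t\<in>{0..1}. k (1, t) = d' t"
    "\<forall>s\<in>{0..1}. k (s, 0) = d 0 \<and> k (s, 1) = d 1"
    using d unfolding rhom_iff by blast
  let ?hk = "\<lambda>p. ((\<lambda>t. h (fst p, t)) +++ (\<lambda>t. k (fst p, t))) (snd p)"
  show ?thesis
    unfolding rhom_iff
  proof (intro exI[of _ ?hk] conjI ballI)
    show "continuous_map (top_of_set ({0..1} \<times> {0..1})) (rips_top E) ?hk"
      using h(4) k(4) cd by (intro continuous_map_joinpaths_family h(1) k(1)) simp
    show "?hk (0, t) = (c +++ d) t" if "t \<in> {0..1}" for t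
      using that h(2) k(2) by (simp add: joinpaths_def)
    show "?hk (1, t) = (c' +++ d') t" if "t \<in> {0..1}" for t
      using that h(3) k(3) by (simp add: joinpaths_def)
    show "?hk (s, 0) = (c +++ d) 0" "?hk (s, 1) = (c +++ d) 1" if "s \<in> {0..1}" for s
      using that h(4) k(4) by (simp_all add: joinpaths_def)
  qed
qed

text \<open>The straight-line homotopy from \<open>r\<close> to the identity runs inside the convex
  parameter interval and is then followed by \<open>c\<close>, so no convexity of the Rips complex
  enters.\<close>

lemma rhom_reparametrize:
  assumes c: "continuous_map (top_of_set {0..1}) (rips_top E) c"
    and r: "continuous_on {0..1} r" "r \<in> {0..1} \<rightarrow> {0..1}" "r 0 = 0" "r 1 = 1"
    and d: "\<And>t. t \<in> {0..1} \<Longrightarrow> d t = c (r t)"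
  shows "rhom E d c"
proof -
  let ?g = "\<lambda>p. (1 - fst p) * r (snd p) + fst p * snd p"
  have "?g p \<in> {0..1}" if "p \<in> {0..1} \<times> {0..1}" for p
  proof -
    have "r (snd p) \<in> {0..1}" using r(2) that by auto
    then have "(1 - fst p) *\<^sub>R r (snd p) + fst p *\<^sub>R snd p \<in> {0..1}"
      using that by (intro convexD[OF convex_real_interval(5)]) auto
    then show ?thesis by simp
  qed
  then have "?g \<in> {0..1} \<times> {0..1} \<rightarrow> {0..1}" by auto
  moreover have "continuous_on ({0..1} \<times> {0..1}) ?g"
    by (intro continuous_intros continuous_on_compose2[OF r(1)]) auto
  ultimately have "continuous_map (top_of_set ({0..1} \<times> {0..1})) (top_of_set {0..1}) ?g"
    by auto
  then have "continuous_map (top_of_set ({0..1} \<times> {0..1})) (rips_top E) (c \<circ> ?g)"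
    using c by (rule continuous_map_compose)
  then show ?thesis
    unfolding rhom_iff by (intro exI[of _ "c \<circ> ?g"]) (use r d in auto)
qed

text \<open>The product runs \<open>c\<close> at double speed and then rests, which is a
  reparametrization of \<open>c\<close>. Stating constancy pointwise covers constant paths at a
  vertex as well as degenerate edges.\<close>

lemma rhom_join_const_right:
  assumes c: "continuous_map (top_of_set {0..1}) (rips_top E) c" and d: "\<And>t. d t = c 1"
  shows "rhom E (c +++ d) c"
proof (rule rhom_reparametrize[OF c, where r = "\<lambda>t. min (2 * t) 1"])
  show "continuous_on {0..1::real} (\<lambda>t. min (2 * t) 1)"
    by (intro continuous_intros)
qed (auto simp: joinpaths_def d min_def)

lemma rhom_join_const_left:
  assumes c: "continuous_map (top_of_set {0..1}) (rips_top E) c" and d: "\<And>t. d t = c 0"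
  shows "rhom E (d +++ c) c"
proof (rule rhom_reparametrize[OF c, where r = "\<lambda>t. max (2 * t - 1) 0"])
  show "continuous_on {0..1::real} (\<lambda>t. max (2 * t - 1) 0)"
    by (intro continuous_intros)
qed (auto simp: joinpaths_def d max_def)

section \<open>Paths and generalized paths\<close>

lemma rpath_smap:
  assumes "rpath E x y c" "\<And>x y. (x, y) \<in> E \<Longrightarrow> (f x, f y) \<in> F"
  shows "rpath F (f x) (f y) (\<lambda>t. smap f (c t))"
  using assms(1) continuous_map_compose[OF _ continuous_map_smap[OF assms(2)]]
  by (auto simp: rpath_def o_def)

lemma rpath_join:
  assumes "rpath E x y c" "rpath E y z d"
  shows "rpath E x z (c +++ d)"
proof -
  \<comment> \<open>Reflexivity of \<open>rhom\<close> is equivalent to continuity, so the pasting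
    argument behind \<open>rhom_join\<close> also yields continuity of the product.\<close>
  have "rhom E (c +++ d) (c +++ d)"
    using assms by (intro rhom_join) (auto simp: rhom_refl rpath_def)
  then show ?thesis
    using assms by (auto simp: rhom_refl rpath_def joinpaths_def)
qed

lemma gpath_join:
  assumes "gpath x y c" "gpath y z d"
  shows "gpath x z (\<lambda>E. c E +++ d E)"
  unfolding gpath_def
proof (intro conjI ballI impI)
  show "rpath E x z (c E +++ d E)" if "E \<in> entourages" for E
    using assms that by (auto simp: gpath_def intro: rpath_join)
  show "rhom E (c F +++ d F) (c E +++ d E)"
    if "E \<in> entourages" "F \<in> entourages" "F \<subseteq> E" for E F
    using assms that by (intro rhom_join) (auto simp: gpath_def rpath_def)
qed

section \<open>Entourages, countable bases and Cauchy filters\<close>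

lemma entourages_mono: "E \<in> entourages \<Longrightarrow> E \<subseteq> F \<Longrightarrow> F \<in> entourages"
  unfolding entourages_def mem_Collect_eq by (erule eventually_mono) blast

lemma entourages_refl: "E \<in> entourages \<Longrightarrow> (x, x) \<in> E"
  unfolding entourages_def mem_Collect_eq by (rule uniformity_refl)

lemma entourages_Inter:
  "finite I \<Longrightarrow> (\<And>i. i \<in> I \<Longrightarrow> E i \<in> entourages) \<Longrightarrow> (\<Inter>i\<in>I. E i) \<in> entourages"
  by (simp add: entourages_def eventually_ball_finite)

lemma preimage_entourage:
  assumes "generates_uniformity f" "G \<in> entourages"
  shows "{(x, y). (f x, f y) \<in> G} \<in> entourages"
proof -
  obtain E where E: "E \<in> entourages" "rel_image f E \<subseteq> G"
    using assms by (auto simp: generates_uniformity_def)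
  show ?thesis
    by (rule entourages_mono[OF E(1)]) (use E(2) in \<open>force simp: rel_image_def\<close>)
qed

lemma decreasing_entourage_base:
  assumes "countable_uniform_base TYPE('a::uniform_space)"
  obtains E :: "nat \<Rightarrow> ('a::uniform_space \<times> 'a) set" where "\<And>n. E n \<in> entourages" "decseq E"
    "\<And>G. G \<in> entourages \<Longrightarrow> \<exists>n. E n \<subseteq> G"
proof -
  obtain B where B: "countable B" "B \<subseteq> (entourages :: ('a \<times> 'a) set set)"
    "\<forall>E\<in>entourages. \<exists>B'\<in>B. B' \<subseteq> E"
    using assms by (auto simp: countable_uniform_base_def)
  \<comment> \<open>The entourage \<open>UNIV\<close> forces \<open>B\<close> to be nonempty, so
    every value of \<open>from_nat_into B\<close> lies in \<open>B\<close>.\<close>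
  have "UNIV \<in> (entourages :: ('a \<times> 'a) set set)" by (simp add: entourages_def)
  then have "B \<noteq> {}" using B(3) by blast
  show thesis
  proof (rule that[of "\<lambda>n. \<Inter>i\<le>n. from_nat_into B i"])
    show "(\<Inter>i\<le>n. from_nat_into B i) \<in> entourages" for n
      using from_nat_into[OF \<open>B \<noteq> {}\<close>] B(2) by (intro entourages_Inter) auto
    show "decseq (\<lambda>n. \<Inter>i\<le>n. from_nat_into B i)"
      by (auto simp: decseq_def)
    show "\<exists>n. (\<Inter>i\<le>n. from_nat_into B i) \<subseteq> G" if "G \<in> entourages" for G
    proof -
      obtain B' where "B' \<in> B" "B' \<subseteq> G" using B(3) \<open>G \<in> entourages\<close> by blast
      then obtain n where "from_nat_into B n \<subseteq> G"
        using from_nat_into_surj[OF B(1)] by metis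
      then show ?thesis by (intro exI[of _ n]) auto
    qed
  qed
qed

lemma cauchy_filter_entourage:
  assumes "cauchy_filter \<Phi>" "E \<in> entourages"
  shows "\<exists>P. eventually (\<lambda>z. z \<in> P) \<Phi> \<and> P \<times> P \<subseteq> E"
proof -
  have "eventually (\<lambda>p. p \<in> E) (\<Phi> \<times>\<^sub>F \<Phi>)"
    using assms by (auto simp: cauchy_filter_def entourages_def le_filter_def)
  then obtain P where "eventually P \<Phi>" "\<forall>x y. P x \<longrightarrow> P y \<longrightarrow> (x, y) \<in> E"
    by (auto simp: eventually_prod_same)
  then show ?thesis
    by (intro exI[of _ "{x. P x}"]) auto
qed

section \<open>Images of generalized paths and of their concatenations\<close>

lemma gpath_gmap:
  assumes f: "generates_uniformity f" and c: "gpath x y c"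
  shows "gpath (f x) (f y) (gmap f c)"
  unfolding gpath_def
proof (intro conjI ballI impI)
  show "rpath G (f x) (f y) (gmap f c G)" if "G \<in> entourages" for G
    unfolding gmap_def
  proof (rule rpath_smap)
    show "rpath {(x, y). (f x, f y) \<in> G} x y (c {(x, y). (f x, f y) \<in> G})"
      using c preimage_entourage[OF f that] unfolding gpath_def by blast
  qed simp
  show "rhom G (gmap f c H) (gmap f c G)"
    if "G \<in> entourages" "H \<in> entourages" "H \<subseteq> G" for G H
    unfolding gmap_def
  proof (rule rhom_smap)
    have "{(x, y). (f x, f y) \<in> H} \<subseteq> {(x, y). (f x, f y) \<in> G}"
      using that(3) by blast
    then show "rhom {(x, y). (f x, f y) \<in> G} (c {(x, y). (f x, f y) \<in> H}) (c {(x, y). (f x, f y) \<in> G})"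
      using c preimage_entourage[OF f that(1)] preimage_entourage[OF f that(2)]
      unfolding gpath_def by blast
  qed simp
qed

lemma gmap_join: "gmap f (\<lambda>E. c E +++ d E) G = gmap f c G +++ gmap f d G"
  by (auto simp: gmap_def smap_joinpaths)

text \<open>At the scale of the preimage of \<open>G\<close> the path is homotopic to its
  \<open>E\<close>-component and hence to the edge from \<open>x\<close> to \<open>x'\<close>; the
  simplicial map collapses this edge to a vertex because both ends lie in one fiber.\<close>

lemma gmap_gshort_null:
  assumes f: "generates_uniformity f" and c: "gpath x x' c" "gshort E x x' c"
    and E: "E \<in> entourages" and G: "G \<in> entourages" "E \<subseteq> {(x, y). (f x, f y) \<in> G}"
    and fib: "f x = f x'"
  shows "rhom G (gmap f c G) (\<lambda>t. vert (f x))"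
proof -
  let ?G = "{(x, y). (f x, f y) \<in> G}"
  have "rhom ?G (c ?G) (c E)"
    using c(1) E preimage_entourage[OF f G(1)] G(2) unfolding gpath_def by (blast intro: rhom_sym)
  also have "rhom ?G (c E) (edge x x')"
    using c(2) G(2) unfolding gshort_def by (blast intro: rhom_mono)
  finally have "rhom G (\<lambda>t. smap f (c ?G t)) (\<lambda>t. smap f (edge x x' t))"
    by (rule rhom_smap) auto
  then show ?thesis
    by (simp add: gmap_def smap_edge fib)
qed

text \<open>Concatenation is nested to the left, so that the stabilization argument only appends
  constant loops and needs no associativity.\<close>
primrec gconcat :: "(nat \<Rightarrow> ('a \<times> 'a) set \<Rightarrow> real \<Rightarrow> 'a \<Rightarrow> real) \<Rightarrow> nat \<Rightarrow> ('a \<times> 'a) set \<Rightarrow> real \<Rightarrow> 'a \<Rightarrow> real"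
where
  "gconcat c 0 = c 0"
| "gconcat c (Suc n) = (\<lambda>E. gconcat c n E +++ c (Suc n) E)"

lemma gpath_gconcat:
  assumes "\<And>n. gpath (x n) (x (Suc n)) (c n)"
  shows "gpath (x 0) (x (Suc n)) (gconcat c n)"
  by (induction n) (simp_all add: assms gpath_join)

lemma gconcat_stabilizes:
  assumes f: "generates_uniformity f" and c: "\<And>n. gpath (x n) (x (Suc n)) (c n)"
    and G: "G \<in> entourages"
    and null: "\<And>n. n \<ge> N \<Longrightarrow> rhom G (gmap f (c n) G) (\<lambda>t. vert (f (x n)))"
    and n: "N \<le> n"
  shows "rhom G (gmap f (gconcat c n) G) (gmap f (gconcat c N) G)"
  using n
proof (induction n rule: dec_induct)
  case base
  then show ?case
    using gpath_gmap[OF f gpath_gconcat[where c = c, OF c]] G by (auto simp: rhom_refl gpath_def rpath_def)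
next
  case (step n)
  have rp: "rpath G (f (x 0)) (f (x (Suc n))) (gmap f (gconcat c n) G)"
    using gpath_gmap[OF f gpath_gconcat[where c = c, OF c]] G by (auto simp: gpath_def)
  have rp': "rpath G (f (x (Suc n))) (f (x (Suc (Suc n)))) (gmap f (c (Suc n)) G)"
    using gpath_gmap[OF f c] G by (auto simp: gpath_def)
  \<comment> \<open>The new factor may be replaced by the constant path at
    \<open>f (x (Suc n))\<close>, the end-point of the previous image concatenation, and is then
    absorbed.\<close>
  have "rhom G (gmap f (gconcat c (Suc n)) G) (gmap f (gconcat c n) G +++ (\<lambda>t. vert (f (x (Suc n)))))"
    using rp rp' step null[of "Suc n"]
    by (simp add: gmap_join, intro rhom_join) (auto simp: rhom_refl rpath_def)
  also have "rhom G \<dots> (gmap f (gconcat c n) G)"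
    using rp by (intro rhom_join_const_right) (auto simp: rpath_def)
  finally show ?case
    using step.IH by (rule rhom_trans)
qed

section \<open>Lifting the limit loop\<close>

text \<open>The limit is found as the end-point of a GP1 lift. Convergence follows because the
  \<open>G\<close>-homotopy given by GP2 includes \<open>G\<close>-closeness of terminal points; the
  index is \<open>Suc n\<close> because \<open>gconcat c n\<close> ends at
  \<open>x (Suc n)\<close>.\<close>

lemma short_path_sequence_converges:
  fixes f :: "'a::uniform_space \<Rightarrow> 'b::uniform_space"
  assumes f: "gen_uniform_covering f"
    and E: "\<And>n. E n \<in> entourages" "decseq E" "\<And>G. G \<in> entourages \<Longrightarrow> \<exists>n. E n \<subseteq> G"
    and c: "\<And>n. gpath (x n) (x (Suc n)) (c n)" "\<And>n. gshort (E n) (x n) (x (Suc n)) (c n)"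
    and fib: "\<And>n. f (x n) = y"
  obtains x' where "f x' = y" "\<And>G. G \<in> entourages \<Longrightarrow> \<exists>N. \<forall>n\<ge>N. (x (Suc n), x') \<in> G"
proof -
  have gen: "generates_uniformity f"
    and GP1: "\<And>x0 y c. gpath (f x0) y c \<Longrightarrow> \<exists>x d. gpath x0 x d \<and> f x = y \<and>
               (\<forall>F\<in>entourages. rhom F (gmap f d F) (c F))"
    and GP2: "\<And>E. E \<in> entourages \<Longrightarrow> \<exists>F\<in>entourages. \<forall>x0 y c y' d.
        gpath x0 y c \<and> gpath x0 y' d \<and>
        ghom (rel_image f F) (f x0) (f y) (gmap f c) (f x0) (f y') (gmap f d)
        \<longrightarrow> ghom E x0 y c x0 y' d"
    using f unfolding gen_uniform_covering_def by blast+
  let ?C = "\<lambda>n. gmap f (gconcat c n)"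
  have C: "gpath y y (?C n)" for n
    using gpath_gmap[OF gen gpath_gconcat[where c = c, OF c(1)], of n] fib by simp
  \<comment> \<open>Monotonicity turns one good index into all later ones, as needed for every
    factor beyond the threshold to be null at scale \<open>G\<close>.\<close>
  have "\<exists>N. \<forall>n\<ge>N. E n \<subseteq> {(x, y). (f x, f y) \<in> G}" if "G \<in> entourages" for G
    using E(3)[OF preimage_entourage[OF gen that]] E(2) unfolding decseq_def by (meson order_trans)
  then obtain N where N: "\<And>G n. G \<in> entourages \<Longrightarrow> n \<ge> N G \<Longrightarrow> E n \<subseteq> {(x, y). (f x, f y) \<in> G}"
    by metis
  \<comment> \<open>A diagonal choice: the threshold depends on the scale, so different components
    of \<open>D\<close> may come from different finite concatenations.\<close>
  define D where "D = (\<lambda>G. ?C (N G) G)"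
  have CD: "rhom G (?C n G) (D G)" if "G \<in> entourages" "n \<ge> N G" for G n
    unfolding D_def
  proof (rule gconcat_stabilizes[where x = x and c = c, OF gen c(1) that(1) _ that(2)])
    fix m assume "m \<ge> N G"
    then show "rhom G (gmap f (c m) G) (\<lambda>t. vert (f (x m)))"
      using gmap_gshort_null[OF gen c(1) c(2) E(1) that(1) N[OF that(1)]] fib by simp
  qed
  have "gpath y y D"
    unfolding gpath_def
  proof (intro conjI ballI impI)
    show "rpath G y y (D G)" if "G \<in> entourages" for G
      using C that by (auto simp: D_def gpath_def)
    fix G H :: "('b \<times> 'b) set"
    assume GH: "G \<in> entourages" "H \<in> entourages" "H \<subseteq> G"
    \<comment> \<open>Beyond both thresholds a single concatenation represents \<open>D G\<close>
      and \<open>D H\<close>; its own compatibility between the scales \<open>H\<close> and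
      \<open>G\<close> links the two.\<close>
    let ?m = "max (N G) (N H)"
    have "rhom G (D H) (?C ?m H)"
      using rhom_mono[OF rhom_sym[OF CD[OF GH(2), of ?m]] GH(3)] by simp
    also have "rhom G \<dots> (?C ?m G)"
      using C GH by (auto simp: gpath_def)
    also have "rhom G \<dots> (D G)"
      using CD[OF GH(1)] by simp
    finally show "rhom G (D H) (D G)" .
  qed
  then obtain x' d where d: "gpath (x 0) x' d" "f x' = y"
    and dD: "\<And>F. F \<in> entourages \<Longrightarrow> rhom F (gmap f d F) (D F)"
    using GP1[of "x 0" y D] fib by auto
  have "\<exists>N. \<forall>n\<ge>N. (x (Suc n), x') \<in> G" if G: "G \<in> entourages" for G
  proof -
    obtain F where F: "F \<in> entourages"
      and lift: "\<And>x0 y c y' d. gpath x0 y c \<Longrightarrow> gpath x0 y' d \<Longrightarrow>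
        ghom (rel_image f F) (f x0) (f y) (gmap f c) (f x0) (f y') (gmap f d) \<Longrightarrow>
        ghom G x0 y c x0 y' d"
      using GP2[OF G] by blast
    let ?H = "rel_image f F"
    have H: "?H \<in> entourages"
      using gen F by (simp add: generates_uniformity_def)
    have rd: "rpath ?H y y (gmap f d ?H)"
      using gpath_gmap[OF gen d(1)] H fib d(2) by (auto simp: gpath_def)
    \<comment> \<open>The definition of \<open>ehom\<close> pads the second path with edges. Here
      they are constant at \<open>y\<close>, but they still change the parametrization and must be
      absorbed up to homotopy.\<close>
    have const: "rhom ?H (gmap f d ?H +++ edge y y) (gmap f d ?H)"
      using rd by (intro rhom_join_const_right) (auto simp: rpath_def)
    have "rhom ?H (edge y y +++ (gmap f d ?H +++ edge y y)) (gmap f d ?H +++ edge y y)"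
      using rhom_continuous[OF const] rd
      by (intro rhom_join_const_left) (auto simp: rpath_def joinpaths_def)
    then have const2: "rhom ?H (gmap f d ?H) (edge y y +++ (gmap f d ?H +++ edge y y))"
      using const rhom_sym rhom_trans by blast
    have "(x (Suc n), x') \<in> G" if "n \<ge> N ?H" for n
    proof -
      have "rhom ?H (?C n ?H) (gmap f d ?H)"
        using CD[OF H that] rhom_sym[OF dD[OF H]] by (rule rhom_trans)
      then have "rhom ?H (?C n ?H) (edge y y +++ (gmap f d ?H +++ edge y y))"
        using const2 by (rule rhom_trans)
      then have "ghom ?H (f (x 0)) (f (x (Suc n))) (?C n) (f (x 0)) (f x') (gmap f d)"
        using entourages_refl[OF H] by (simp add: ghom_def ehom_def fib d(2))
      then have "ghom G (x 0) (x (Suc n)) (gconcat c n) (x 0) x' d"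
        by (rule lift[OF gpath_gconcat[where c = c, OF c(1)] d(1)])
      then show ?thesis
        by (simp add: ghom_def ehom_def)
    qed
    then show ?thesis by blast
  qed
  then show thesis
    using that d(2) by blast
qed

section \<open>Convergence of a Cauchy filter on a fiber\<close>

theorem mainTheorem17:
  fixes f :: "'a::uniform_space \<Rightarrow> 'b::uniform_space"
  assumes "uniformly_joinable TYPE('a)"
    and "countable_uniform_base TYPE('a)"
    and "gen_uniform_covering f"
  shows "\<forall>y. complete_subset (f -` {y})"
  unfolding complete_subset_def
proof (intro allI impI, elim conjE)
  fix y and \<Phi> :: "'a filter"
  assume \<Phi>: "\<Phi> \<noteq> bot" "\<Phi> \<le> principal (f -` {y})" "cauchy_filter \<Phi>"
  obtain E :: "nat \<Rightarrow> ('a \<times> 'a) set" where E: "\<And>n. E n \<in> entourages" "decseq E"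
    "\<And>G. G \<in> entourages \<Longrightarrow> \<exists>n. E n \<subseteq> G"
    using decreasing_entourage_base[OF assms(2)] by blast
  \<comment> \<open>A set of the filter that is small for the entourage given by joinability at
    \<open>E n\<close>. Since \<open>gshort\<close> contains the pair condition, \<open>P n\<close>
    is also \<open>E n\<close>-small, which is used again at the end.\<close>
  have "\<exists>P. eventually (\<lambda>z. z \<in> P) \<Phi> \<and> (\<forall>a\<in>P. \<forall>b\<in>P. \<exists>c. gpath a b c \<and> gshort (E n) a b c)" for n
  proof -
    obtain F :: "('a \<times> 'a) set" where F: "F \<in> entourages"
      "\<forall>(a, b)\<in>F. \<exists>c. gpath a b c \<and> gshort (E n) a b c"
      using assms(1) E(1)[of n] unfolding uniformly_joinable_def by blast
    show ?thesis
      using cauchy_filter_entourage[OF \<Phi>(3) F(1)] F(2) by fast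
  qed
  then obtain P where P: "\<And>n. eventually (\<lambda>z. z \<in> P n) \<Phi>"
    and P_short: "\<And>n a b. a \<in> P n \<Longrightarrow> b \<in> P n \<Longrightarrow> \<exists>c. gpath a b c \<and> gshort (E n) a b c"
    by metis
  \<comment> \<open>The sets \<open>P i\<close> need not be nested. Choosing \<open>x n\<close> in
    all of them up to \<open>n\<close> puts \<open>x n\<close> and \<open>x (Suc n)\<close> together
    in \<open>P n\<close>, and keeps all later points in any given \<open>P m\<close>.\<close>
  have "eventually (\<lambda>z. z \<in> f -` {y} \<and> (\<forall>i\<in>{..n}. z \<in> P i)) \<Phi>" for n
    using \<Phi>(2) P by (intro eventually_conj eventually_ball_finite) (auto simp: le_principal)
  then have "\<exists>z. f z = y \<and> (\<forall>i\<in>{..n}. z \<in> P i)" for n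
    using eventually_happens'[OF \<Phi>(1)] by fastforce
  then obtain x where x: "\<And>n. f (x n) = y" "\<And>n i. i \<le> n \<Longrightarrow> x n \<in> P i"
    by (metis atMost_iff)
  have "\<exists>c. gpath (x n) (x (Suc n)) c \<and> gshort (E n) (x n) (x (Suc n)) c" for n
    using x(2) by (intro P_short) auto
  then obtain c where c: "\<And>n. gpath (x n) (x (Suc n)) (c n)"
    "\<And>n. gshort (E n) (x n) (x (Suc n)) (c n)"
    by metis
  obtain x' where x': "f x' = y" "\<And>G. G \<in> entourages \<Longrightarrow> \<exists>N. \<forall>n\<ge>N. (x (Suc n), x') \<in> G"
    using short_path_sequence_converges[OF assms(3) E c x(1)] by blast
  have "\<Phi> \<le> nhds x'"
    unfolding le_filter_def
  proof (intro allI impI)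
    fix Q assume "eventually Q (nhds x')"
    then have "eventually (\<lambda>(a, b). a = x' \<longrightarrow> Q b) uniformity"
      by (simp add: eventually_nhds_uniformity)
    \<comment> \<open>The entourage is flipped because the sequence approaches \<open>x'\<close> in
      the second coordinate; \<open>R\<close> then halves it, leaving room for an intermediate point
      of the sequence.\<close>
    then have "eventually (\<lambda>(a, b). b = x' \<longrightarrow> Q a) uniformity"
      by (drule_tac uniformity_sym) (simp add: case_prod_unfold)
    then obtain R where R: "eventually R uniformity"
      "\<And>a b c. R (a, b) \<Longrightarrow> R (b, c) \<Longrightarrow> c = x' \<longrightarrow> Q a"
      by (rule uniformity_transE) auto
    have R': "{p. R p} \<in> entourages" using R(1) by (simp add: entourages_def)
    obtain m where m: "E m \<subseteq> {p. R p}" using E(3)[OF R'] by blast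
    obtain N where N: "\<forall>n\<ge>N. (x (Suc n), x') \<in> {p. R p}" using x'(2)[OF R'] by blast
    \<comment> \<open>For this index \<open>x (Suc ?n)\<close> lies in \<open>P m\<close> and is
      \<open>R\<close>-close to \<open>x'\<close>, so it serves as the intermediate point for every
      \<open>a\<close> in \<open>P m\<close>.\<close>
    let ?n = "max m N"
    have "Q a" if "a \<in> P m" for a
    proof -
      have "(a, x (Suc ?n)) \<in> E m"
        using P_short[OF that, of "x (Suc ?n)"] x(2) by (auto simp: gshort_def)
      then show ?thesis using R(2)[of a "x (Suc ?n)" x'] m N by auto
    qed
    then show "eventually Q \<Phi>"
      using P[of m] by (auto elim: eventually_mono)
  qed
  then show "\<exists>x\<in>f -` {y}. \<Phi> \<le> nhds x"
    using x'(1) by auto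
qed

end
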